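(* Let $\varphi$ be a noninjective self-map of $T$ such that $C_\varphi$ is bounded on $\mathcal{L}_0$, and let $\lambda\in\mathbb{C}$. Then $\lambda C_\varphi$ is not hypercyclic on $\mathcal{L}_0$.
   Context: $T$ is an infinite, locally finite tree (connected graph without cycles, identified with its vertex set) with a chosen root $o$, in which every vertex except possibly $o$ has degree greater than $1$. $d(v,w)$ is the number of edges of the unique path joining $v$ and $w$, and $|v|=d(o,v)$. $T^*=T\setminus\{o\}$. For $v\in T^*$, the parent $v^-$ is the neighbor of $v$ on the path from $o$ to $v$. The Lipschitz space $\mathcal{L}$ is the set of $f:T\to\mathbb{C}$ with $\sup_{v\in T^*}|f(v)-f(v^-)|<\infty$, a Banach space under $\|f\|_{\mathcal{L}}=\max\{|f(o)|,\sup_{v\in T^*}|f(v)-f(v^-)|\}$. The little Lipschitz space $\mathcal{L}_0$ is the closed subspace of $f\in\mathcal{L}$ with $\lim_{|v|\to\infty}|f(v)-f(v^-)|=0$. The composition operator is $C_\varphi f=f\circ\varphi$; it is bounded on $\mathcal{L}_0$ if it maps $\mathcal{L}_0$ into itself and is a bounded operator there. A bounded operator $A$ on a Banach space is hypercyclic if there is a vector $f$ whose orbit $\{A^nf:n\ge 0\}$ is dense. *)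

theory Defs
  imports "HOL-Analysis.Analysis"
begin

section \<open>Rooted trees\<close>

text \<open>
  A graph is given by its adjacency relation \<open>E\<close>; its vertex set is the whole type \<open>'v\<close>.
\<close>

definition is_path :: "('v \<Rightarrow> 'v \<Rightarrow> bool) \<Rightarrow> 'v \<Rightarrow> 'v list \<Rightarrow> 'v \<Rightarrow> bool" where
  "is_path E v p w \<longleftrightarrow>
     p \<noteq> [] \<and> hd p = v \<and> last p = w \<and> distinct p \<and> successively E p"

definition is_cycle :: "('v \<Rightarrow> 'v \<Rightarrow> bool) \<Rightarrow> 'v list \<Rightarrow> bool" where
  "is_cycle E p \<longleftrightarrow> length p \<ge> 3 \<and> distinct p \<and> successively E p \<and> E (last p) (hd p)"

locale rooted_tree =
  fixes E :: "'v \<Rightarrow> 'v \<Rightarrow> bool" and r :: 'v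
  assumes adj_sym: "E v w \<Longrightarrow> E w v"
    and adj_irrefl: "\<not> E v v"
    and connected: "\<exists>p. is_path E v p w"
    and no_cycle: "\<not> is_cycle E p"
    and infinite_vertices: "infinite (UNIV :: 'v set)"
    and locally_finite: "finite {w. E v w}"
    and degree_gt_1: "v \<noteq> r \<Longrightarrow> card {w. E v w} > 1"

definition tree_path :: "('v \<Rightarrow> 'v \<Rightarrow> bool) \<Rightarrow> 'v \<Rightarrow> 'v \<Rightarrow> 'v list" where
  "tree_path E v w = (THE p. is_path E v p w)"

text \<open>The number of edges of a path is one less than its number of vertices.\<close>

definition tree_dist :: "('v \<Rightarrow> 'v \<Rightarrow> bool) \<Rightarrow> 'v \<Rightarrow> 'v \<Rightarrow> nat" where
  "tree_dist E v w = length (tree_path E v w) - 1"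

text \<open>Only meaningful for \<open>v \<noteq> r\<close>.\<close>

definition parent :: "('v \<Rightarrow> 'v \<Rightarrow> bool) \<Rightarrow> 'v \<Rightarrow> 'v \<Rightarrow> 'v" where
  "parent E r v = (THE u. E v u \<and> u \<in> set (tree_path E r v))"


section \<open>The Lipschitz space and the little Lipschitz space\<close>

definition lip :: "('v \<Rightarrow> 'v \<Rightarrow> bool) \<Rightarrow> 'v \<Rightarrow> ('v \<Rightarrow> complex) set" where
  "lip E r = {f. bdd_above ((\<lambda>v. cmod (f v - f (parent E r v))) ` (UNIV - {r}))}"

definition lip_norm :: "('v \<Rightarrow> 'v \<Rightarrow> bool) \<Rightarrow> 'v \<Rightarrow> ('v \<Rightarrow> complex) \<Rightarrow> real" where
  "lip_norm E r f =
     max (cmod (f r)) (SUP v\<in>UNIV - {r}. cmod (f v - f (parent E r v)))"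

text \<open>
  The filter \<open>filtercomap (tree_dist E r) at_top\<close> expresses that \<open>v\<close> moves away from the root
  indefinitely; the root itself is eventually excluded.
\<close>

definition lip0 :: "('v \<Rightarrow> 'v \<Rightarrow> bool) \<Rightarrow> 'v \<Rightarrow> ('v \<Rightarrow> complex) set" where
  "lip0 E r = {f \<in> lip E r.
     ((\<lambda>v. cmod (f v - f (parent E r v))) \<longlongrightarrow> 0) (filtercomap (tree_dist E r) at_top)}"


section \<open>Operators on spaces of functions\<close>

text \<open>
  A normed space of complex functions is given by its carrier \<open>X\<close> and its norm \<open>N\<close>, with
  pointwise vector space operations.
\<close>

definition bounded_operator_on ::
    "('v \<Rightarrow> complex) set \<Rightarrow> (('v \<Rightarrow> complex) \<Rightarrow> real)
      \<Rightarrow> (('v \<Rightarrow> complex) \<Rightarrow> ('v \<Rightarrow> complex)) \<Rightarrow> bool" where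
  "bounded_operator_on X N A \<longleftrightarrow>
     A ` X \<subseteq> X \<and>
     (\<forall>f\<in>X. \<forall>g\<in>X. \<forall>a b. A (\<lambda>v. a * f v + b * g v) = (\<lambda>v. a * A f v + b * A g v)) \<and>
     (\<exists>K. \<forall>f\<in>X. N (A f) \<le> K * N f)"

definition norm_dist ::
    "(('v \<Rightarrow> complex) \<Rightarrow> real) \<Rightarrow> ('v \<Rightarrow> complex) \<Rightarrow> ('v \<Rightarrow> complex) \<Rightarrow> real" where
  "norm_dist N f g = N (\<lambda>v. f v - g v)"

definition hypercyclic_on ::
    "('v \<Rightarrow> complex) set \<Rightarrow> (('v \<Rightarrow> complex) \<Rightarrow> real)
      \<Rightarrow> (('v \<Rightarrow> complex) \<Rightarrow> ('v \<Rightarrow> complex)) \<Rightarrow> bool" where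
  "hypercyclic_on X N A \<longleftrightarrow>
     (\<exists>f\<in>X. Metric_space.mtopology X (norm_dist N) closure_of (range (\<lambda>n. (A ^^ n) f)) = X)"

definition composition_op :: "('v \<Rightarrow> 'v) \<Rightarrow> ('v \<Rightarrow> complex) \<Rightarrow> ('v \<Rightarrow> complex)" where
  "composition_op \<phi> f = f \<circ> \<phi>"


section \<open>The notions above are well defined\<close>

context rooted_tree
begin

lemma path_unique:
  assumes "is_path E v p w" "is_path E v q w"
  shows "p = q"
  using assms
proof (induction p arbitrary: v q)
  case Nil
  then show ?case by (simp add: is_path_def)
next
  case (Cons a p)
  obtain q' where q: "q = v # q'" and a: "a = v"
    using Cons.prems by (cases q) (auto simp: is_path_def)
  show ?case
  proof (cases "p = [] \<or> q' = []")
    case True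
    have "v = w"
      using True Cons.prems q a by (auto simp: is_path_def)
    then have "p = []" "q' = []"
      using Cons.prems q a last_in_set by (fastforce simp: is_path_def split: if_splits)+
    then show ?thesis using q a by simp
  next
    case ne: False
    have P: "is_path E (hd p) p w" "v \<notin> set p" "E v (hd p)"
      using Cons.prems(1) ne a by (auto simp: is_path_def successively_Cons)
    have Q: "is_path E (hd q') q' w" "v \<notin> set q'" "E v (hd q')"
      using Cons.prems(2) ne q by (auto simp: is_path_def successively_Cons)
    show ?thesis
    proof (cases "hd p = hd q'")
      case True
      then show ?thesis using Cons.IH[of "hd p" q'] P Q a q by simp
    next
      case False
      have "\<exists>x\<in>set p. x \<in> set q'"
        using P(1) Q(1) by (metis is_path_def last_in_set)
      then obtain xs x ys where p: "p = xs @ x # ys" "x \<in> set q'" "\<forall>y\<in>set xs. y \<notin> set q'"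
        using split_list_first_prop[of p "\<lambda>x. x \<in> set q'"] by blast
      then obtain cs ds where c: "q' = cs @ x # ds"
        by (meson split_list)
      let ?c = "v # xs @ x # rev cs"
      have "distinct ?c"
        using P Q p c by (auto simp: is_path_def)
      moreover have "length ?c \<ge> 3"
        using False p c by (cases xs; cases cs) auto
      moreover have "successively E (v # xs @ [x])"
        using P p by (auto simp: is_path_def successively_Cons successively_append_iff hd_append)
      moreover have "successively E (x # rev cs)"
      proof -
        have "successively E (cs @ [x])"
          using Q(1) c by (auto simp: is_path_def successively_append_iff)
        then have "successively (\<lambda>x y. E y x) (cs @ [x])"
          by (rule successively_mono) (auto intro: adj_sym)
        then show ?thesis
          using successively_rev[of E "cs @ [x]"] by simp
      qed
      ultimately have "successively E ?c"
        by (cases cs rule: rev_cases)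
          (auto simp: successively_append_iff successively_Cons hd_append)
      moreover have "E (last ?c) (hd ?c)"
        using Q(3) c adj_sym by (cases cs) auto
      ultimately have "is_cycle E ?c"
        using \<open>distinct ?c\<close> \<open>length ?c \<ge> 3\<close> by (simp add: is_cycle_def)
      then show ?thesis using no_cycle by blast
    qed
  qed
qed

lemma tree_path_eqI: "is_path E v p w \<Longrightarrow> tree_path E v w = p"
  unfolding tree_path_def by (rule the_equality) (auto intro: path_unique)

lemma is_path_tree_path: "is_path E v (tree_path E v w) w"
  using connected tree_path_eqI by metis

lemma tree_path_parent:
  assumes "v \<noteq> r"
  shows "tree_path E r v = tree_path E r (parent E r v) @ [v]" "E v (parent E r v)"
proof -
  have P: "is_path E r (tree_path E r v) v" by (rule is_path_tree_path)
  obtain p where p: "tree_path E r v = p @ [v]"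
    using P by (cases "tree_path E r v" rule: rev_cases) (auto simp: is_path_def)
  have "p \<noteq> []" using P p assms by (auto simp: is_path_def)
  then obtain q u where q: "p = q @ [u]" by (meson rev_exhaust)
  have u: "E v u" "is_path E r p u"
    using P p q adj_sym by (auto simp: is_path_def successively_append_iff hd_append)
  have "parent E r v = u"
    unfolding parent_def
  proof (rule the_equality)
    show "E v u \<and> u \<in> set (tree_path E r v)" using u p q by simp
  next
    fix u' assume u': "E v u' \<and> u' \<in> set (tree_path E r v)"
    show "u' = u"
    proof (rule ccontr)
      assume "u' \<noteq> u"
      moreover have "u' \<noteq> v" using u' adj_irrefl by auto
      ultimately have "u' \<in> set q" using u' p q by auto
      then obtain xs ys where x: "q = xs @ u' # ys" by (meson split_list)
      have "is_cycle E (u' # ys @ [u, v])"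
        using P u' by (auto simp: is_path_def is_cycle_def p q x successively_append_iff)
      then show False using no_cycle by blast
    qed
  qed
  then show "tree_path E r v = tree_path E r (parent E r v) @ [v]" "E v (parent E r v)"
    using u p tree_path_eqI by auto
qed

lemma tree_dist_parent:
  assumes "v \<noteq> r"
  shows "tree_dist E r v = Suc (tree_dist E r (parent E r v))"
  using tree_path_parent(1)[OF assms] is_path_tree_path[of r "parent E r v"]
  by (cases "tree_path E r (parent E r v)") (auto simp: tree_dist_def is_path_def)

lemma lip_norm_bounds:
  assumes "f \<in> lip E r"
  shows "cmod (f r) \<le> lip_norm E r f"
    and "v \<noteq> r \<Longrightarrow> cmod (f v - f (parent E r v)) \<le> lip_norm E r f"
  using assms
  by (auto simp: lip_norm_def lip_def intro!: max.coboundedI2 cSUP_upper)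

lemma lip_norm_leI:
  assumes "cmod (f r) \<le> B" "\<And>v. v \<noteq> r \<Longrightarrow> cmod (f v - f (parent E r v)) \<le> B"
  shows "f \<in> lip E r" "lip_norm E r f \<le> B"
proof -
  show "f \<in> lip E r" using assms by (auto simp: lip_def intro!: bdd_aboveI2)
  have "UNIV - {r} \<noteq> {}"
    using infinite_vertices by (metis Diff_eq_empty_iff finite.simps finite_subset)
  then show "lip_norm E r f \<le> B"
    using assms by (auto simp: lip_norm_def intro!: cSUP_least)
qed

lemma cmod_le_lip_norm:
  assumes "f \<in> lip E r"
  shows "cmod (f v) \<le> (1 + real (tree_dist E r v)) * lip_norm E r f"
proof (induction "tree_dist E r v" arbitrary: v rule: less_induct)
  case less
  have N: "0 \<le> lip_norm E r f"
    using lip_norm_bounds(1)[OF assms] norm_ge_zero order_trans by blast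
  show ?case
  proof (cases "v = r")
    case True
    have "1 * lip_norm E r f \<le> (1 + real (tree_dist E r v)) * lip_norm E r f"
      using N by (intro mult_right_mono) auto
    then show ?thesis using True lip_norm_bounds(1)[OF assms] by simp
  next
    case False
    have "cmod (f v) \<le> cmod (f (parent E r v)) + cmod (f v - f (parent E r v))"
      using norm_triangle_sub by blast
    also have "\<dots> \<le> (1 + real (tree_dist E r (parent E r v))) * lip_norm E r f + lip_norm E r f"
      using less.hyps[of "parent E r v"] tree_dist_parent[OF False] lip_norm_bounds(2)[OF assms False]
      by (intro add_mono) auto
    finally show ?thesis using tree_dist_parent[OF False] by (simp add: algebra_simps)
  qed
qed

lemma lip_diff:
  assumes "f \<in> lip E r" "g \<in> lip E r"
  shows "(\<lambda>v. f v - g v) \<in> lip E r"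
    and "lip_norm E r (\<lambda>v. f v - g v) \<le> lip_norm E r f + lip_norm E r g"
proof -
  have *: "cmod (f v - g v - (f (parent E r v) - g (parent E r v))) \<le> lip_norm E r f + lip_norm E r g"
    if "v \<noteq> r" for v
  proof -
    have eq: "f v - g v - (f (parent E r v) - g (parent E r v))
        = (f v - f (parent E r v)) - (g v - g (parent E r v))" by simp
    show ?thesis unfolding eq
      using norm_triangle_ineq4[of "f v - f (parent E r v)" "g v - g (parent E r v)"]
        lip_norm_bounds(2)[OF assms(1) that] lip_norm_bounds(2)[OF assms(2) that] by simp
  qed
  have "cmod (f r - g r) \<le> lip_norm E r f + lip_norm E r g"
    using norm_triangle_ineq4[of "f r" "g r"]
      lip_norm_bounds(1)[OF assms(1)] lip_norm_bounds(1)[OF assms(2)] by simp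
  with * show "(\<lambda>v. f v - g v) \<in> lip E r"
    "lip_norm E r (\<lambda>v. f v - g v) \<le> lip_norm E r f + lip_norm E r g"
    by (auto intro!: lip_norm_leI)
qed

lemma Metric_space_lip: "Metric_space (lip E r) (norm_dist (lip_norm E r))"
proof
  fix f g :: "'v \<Rightarrow> complex"
  show "0 \<le> norm_dist (lip_norm E r) f g"
    by (simp add: norm_dist_def lip_norm_def le_max_iff_disj)
  have "cmod (f v - g v - (f (parent E r v) - g (parent E r v)))
      = cmod (g v - f v - (g (parent E r v) - f (parent E r v)))" for v
    by (metis (no_types, lifting) minus_diff_eq norm_minus_commute diff_minus_eq_add minus_diff_commute)
  then show "norm_dist (lip_norm E r) f g = norm_dist (lip_norm E r) g f"
    by (simp add: norm_dist_def lip_norm_def norm_minus_commute)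
next
  fix f g assume fg: "f \<in> lip E r" "g \<in> lip E r"
  show "norm_dist (lip_norm E r) f g = 0 \<longleftrightarrow> f = g"
  proof
    assume "norm_dist (lip_norm E r) f g = 0"
    then have "cmod (f v - g v) \<le> 0" for v
      using cmod_le_lip_norm[OF lip_diff(1)[OF fg], of v] by (simp add: norm_dist_def)
    then show "f = g" by auto
  next
    assume "f = g"
    moreover have "lip_norm E r (\<lambda>v. 0) \<le> 0" by (rule lip_norm_leI) auto
    moreover have "0 \<le> lip_norm E r (\<lambda>v. 0)" by (simp add: lip_norm_def le_max_iff_disj)
    ultimately show "norm_dist (lip_norm E r) f g = 0" by (simp add: norm_dist_def)
  qed
next
  fix f g h assume fgh: "f \<in> lip E r" "g \<in> lip E r" "h \<in> lip E r"
  have "lip_norm E r (\<lambda>v. f v - h v) \<le> lip_norm E r (\<lambda>v. f v - g v) + lip_norm E r (\<lambda>v. g v - h v)"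
  proof (rule lip_norm_leI(2))
    have "cmod (f r - h r) \<le> cmod (f r - g r) + cmod (g r - h r)"
      using norm_triangle_ineq[of "f r - g r" "g r - h r"] by simp
    then show "cmod (f r - h r) \<le> lip_norm E r (\<lambda>v. f v - g v) + lip_norm E r (\<lambda>v. g v - h v)"
      using lip_norm_bounds(1)[OF lip_diff(1)[OF fgh(1,2)]]
        lip_norm_bounds(1)[OF lip_diff(1)[OF fgh(2,3)]] by simp
  next
    fix v assume v: "v \<noteq> r"
    let ?u = "parent E r v"
    have "cmod (f v - h v - (f ?u - h ?u))
        \<le> cmod (f v - g v - (f ?u - g ?u)) + cmod (g v - h v - (g ?u - h ?u))"
      using norm_triangle_ineq[of "f v - g v - (f ?u - g ?u)" "g v - h v - (g ?u - h ?u)"]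
      by (simp add: algebra_simps)
    then show "cmod (f v - h v - (f ?u - h ?u))
        \<le> lip_norm E r (\<lambda>v. f v - g v) + lip_norm E r (\<lambda>v. g v - h v)"
      using lip_norm_bounds(2)[OF lip_diff(1)[OF fgh(1,2)] v]
        lip_norm_bounds(2)[OF lip_diff(1)[OF fgh(2,3)] v] by simp
  qed
  then show "norm_dist (lip_norm E r) f h
      \<le> norm_dist (lip_norm E r) f g + norm_dist (lip_norm E r) g h"
    by (simp add: norm_dist_def)
qed

lemma Metric_space_lip0: "Metric_space (lip0 E r) (norm_dist (lip_norm E r))"
  using Metric_space.subspace[OF Metric_space_lip] by (simp add: lip0_def subset_eq)

end

end

theory Submission
  imports Defs
begin

text \<open>
  If \<open>\<phi> a = \<phi> b\<close> with \<open>a \<noteq> b\<close>, then the continuous functional \<open>g \<mapsto> g a - g b\<close> vanishes on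
  every orbit element except possibly the initial one, so it takes at most two values on an
  orbit. On the little Lipschitz space it takes every complex value, so no orbit is dense.
\<close>

context rooted_tree
begin

text \<open>The increment at \<open>v\<close> can be nonzero only if \<open>v\<close> or its parent
  is \<open>a\<close>, hence only within distance \<open>Suc (tree_dist E r a)\<close> of the
  root.\<close>

lemma point_mass_in_lip0: "(\<lambda>v. if v = a then z else 0) \<in> lip0 E r"
proof -
  let ?g = "\<lambda>v. if v = a then z else 0"
  have "?g \<in> lip E r"
    by (rule lip_norm_leI(1)[where B = "cmod z"]) auto
  moreover have "\<forall>\<^sub>F v in filtercomap (tree_dist E r) at_top. cmod (?g v - ?g (parent E r v)) = 0"
    unfolding eventually_filtercomap
  proof (intro exI conjI allI impI)
    show "\<forall>\<^sub>F n in at_top. Suc (tree_dist E r a) < n" by (rule eventually_gt_at_top)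
    fix v assume far: "Suc (tree_dist E r a) < tree_dist E r v"
    \<comment> \<open>The root has distance 0, so it is excluded and \<open>tree_dist_parent\<close>
      applies to \<open>v\<close>.\<close>
    have "r \<noteq> v"
      using far tree_path_eqI[of r "[r]" r] by (auto simp: tree_dist_def is_path_def)
    then show "cmod (?g v - ?g (parent E r v)) = 0"
      using far tree_dist_parent[of v] by auto
  qed
  ultimately show ?thesis
    by (simp add: lip0_def tendsto_eventually)
qed

text \<open>Continuity of the functional \<open>f a - f b\<close>: the constant adds the growth
  bounds \<open>1 + tree_dist E r v\<close> at the two points.\<close>

lemma cmod_diff_le_lip_norm:
  assumes "f \<in> lip E r"
  shows "cmod (f a - f b) \<le> (2 + real (tree_dist E r a) + real (tree_dist E r b)) * lip_norm E r f"
  using norm_triangle_ineq4[of "f a" "f b"] cmod_le_lip_norm[OF assms, of a]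
    cmod_le_lip_norm[OF assms, of b]
  by (simp add: algebra_simps)

end

theorem proposition5p3:
  fixes E :: "'v \<Rightarrow> 'v \<Rightarrow> bool" and r :: 'v and \<phi> :: "'v \<Rightarrow> 'v" and c :: complex
  assumes "rooted_tree E r"
    and "\<not> inj \<phi>"
    and "bounded_operator_on (lip0 E r) (lip_norm E r) (composition_op \<phi>)"
  shows "\<not> hypercyclic_on (lip0 E r) (lip_norm E r) (\<lambda>f v. c * composition_op \<phi> f v)"
proof
  interpret rooted_tree E r by fact
  interpret M: Metric_space "lip0 E r" "norm_dist (lip_norm E r)" by (rule Metric_space_lip0)
  let ?A = "\<lambda>f v. c * composition_op \<phi> f v"
  obtain a b where ab: "a \<noteq> b" "\<phi> a = \<phi> b" using \<open>\<not> inj \<phi>\<close> by (auto simp: inj_def)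
  assume "hypercyclic_on (lip0 E r) (lip_norm E r) ?A"
  then obtain f where dense: "M.mtopology closure_of (range (\<lambda>n. (?A ^^ n) f)) = lip0 E r"
    by (auto simp: hypercyclic_on_def)
  \<comment> \<open>For positive \<open>n\<close> the iterate is \<open>c\<close> times a function
    composed with \<open>\<phi>\<close>, hence equal at \<open>a\<close> and \<open>b\<close>;
    \<open>n = 0\<close> leaves \<open>f a - f b\<close>.\<close>
  have orbit: "(?A ^^ n) f a - (?A ^^ n) f b \<in> {0, f a - f b}" for n
    by (cases n) (auto simp: composition_op_def ab)
  obtain z where z: "z \<notin> {0, f a - f b}"
    using ex_new_if_finite[OF infinite_UNIV_char_0, of "{0, f a - f b}"] by blast
  define g where "g = (\<lambda>v. if v = a then z else 0)"
  have g: "g \<in> lip0 E r" unfolding g_def by (rule point_mass_in_lip0)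
  define K where "K = 2 + real (tree_dist E r a) + real (tree_dist E r b)"
  \<comment> \<open>The distance from \<open>z\<close> to the two values possible on the orbit. An
    orbit element within \<open>e / K\<close> of \<open>g\<close> would have its value closer than
    \<open>e\<close> to \<open>z\<close>.\<close>
  define e where "e = min (cmod z) (cmod (z - (f a - f b)))"
  have "K > 0" "e > 0" using z by (auto simp: K_def e_def)
  then have "e / K > 0" by simp
  moreover have "g \<in> M.mtopology closure_of (range (\<lambda>n. (?A ^^ n) f))"
    unfolding dense by (rule g)
  then have "\<forall>\<epsilon>>0. \<exists>h\<in>range (\<lambda>n. (?A ^^ n) f). h \<in> M.mball g \<epsilon>"
    unfolding M.metric_closure_of by blast
  ultimately obtain n where "(?A ^^ n) f \<in> M.mball g (e / K)"
    by blast
  then have h: "(?A ^^ n) f \<in> lip0 E r"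
    and near: "norm_dist (lip_norm E r) g ((?A ^^ n) f) < e / K"
    by (simp_all only: M.in_mball)
  define h where "h = (?A ^^ n) f"
  have "(\<lambda>v. g v - h v) \<in> lip E r"
    using g h by (auto simp: lip0_def h_def intro: lip_diff(1))
  then have "cmod ((g a - h a) - (g b - h b)) \<le> K * lip_norm E r (\<lambda>v. g v - h v)"
    unfolding K_def by (rule cmod_diff_le_lip_norm)
  also have "\<dots> < e"
    using near \<open>K > 0\<close> by (simp add: norm_dist_def h_def pos_less_divide_eq mult.commute)
  \<comment> \<open>Since \<open>b \<noteq> a\<close>, \<open>g b = 0\<close>, so the functional
    takes the value \<open>z\<close> at \<open>g\<close>.\<close>
  also have "(g a - h a) - (g b - h b) = z - (h a - h b)"
    using ab by (simp add: g_def)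
  finally show False
    using orbit[of n] by (auto simp: e_def h_def)
qed

end
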